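(* Given any prime $p$ and any integer $n\geq 0$, there exist a finite $p$-group $G$ and a conjugacy class $\operatorname{Cl}(a)$ of $G$ with $|\operatorname{Cl}(a)|=p^n$, $\operatorname{Cl}(a)\neq \operatorname{Cl}(a^{-1})$ and $\eta(\operatorname{Cl}(a)\operatorname{Cl}(a^{-1}))=n(p-1)+1$.
   Context: For a finite group $G$ and $a\in G$, $\operatorname{Cl}(a)=\{gag^{-1}\mid g\in G\}$ is the conjugacy class of $a$ in $G$. For subsets $X,Y$ of $G$, $XY=\{xy\mid x\in X, y\in Y\}$. If a subset $X$ of $G$ is $G$-invariant (stable under conjugation by all elements of $G$), then $X$ is a union of $m$ distinct conjugacy classes of $G$ for some integer $m$, and $\eta(X)=m$ denotes this number. A product of two conjugacy classes is $G$-invariant. *)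

theory Defs
  imports "HOL-Computational_Algebra.Primes" "HOL-Algebra.Coset"
begin

definition finite_p_group :: "nat \<Rightarrow> ('a, 'b) monoid_scheme \<Rightarrow> bool" where
  "finite_p_group p G \<longleftrightarrow>
     group G \<and> finite (carrier G) \<and> (\<exists>k. card (carrier G) = p ^ k)"

definition conj_class :: "('a, 'b) monoid_scheme \<Rightarrow> 'a \<Rightarrow> 'a set" where
  "conj_class G a = {g \<otimes>\<^bsub>G\<^esub> a \<otimes>\<^bsub>G\<^esub> inv\<^bsub>G\<^esub> g | g. g \<in> carrier G}"

definition conj_invariant :: "('a, 'b) monoid_scheme \<Rightarrow> 'a set \<Rightarrow> bool" where
  "conj_invariant G X \<longleftrightarrow>
     X \<subseteq> carrier G \<and>
     (\<forall>g\<in>carrier G. \<forall>x\<in>X. g \<otimes>\<^bsub>G\<^esub> x \<otimes>\<^bsub>G\<^esub> inv\<^bsub>G\<^esub> g \<in> X)"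

text \<open>
  The number of distinct conjugacy classes that meet \<open>X\<close>.  It is only meaningful
  for invariant \<open>X\<close>, where it is the number of classes of which \<open>X\<close> is the union
  (lemmas \<open>Union_conj_classes\<close> and \<open>eta_eq_card\<close> below).
\<close>

definition eta :: "('a, 'b) monoid_scheme \<Rightarrow> 'a set \<Rightarrow> nat" where
  "eta G X = card (conj_class G ` X)"

context group
begin

lemma conj_class_refl: "a \<in> carrier G \<Longrightarrow> a \<in> conj_class G a"
  unfolding conj_class_def by (force intro: exI[of _ \<one>])

lemma conj_class_subset: "a \<in> carrier G \<Longrightarrow> conj_class G a \<subseteq> carrier G"
  unfolding conj_class_def by auto

lemma conj_conj:
  assumes "g \<in> carrier G" "h \<in> carrier G" "a \<in> carrier G"
  shows "g \<otimes> (h \<otimes> a \<otimes> inv h) \<otimes> inv g = (g \<otimes> h) \<otimes> a \<otimes> inv (g \<otimes> h)"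
  using assms by (simp add: m_assoc inv_mult_group)

lemma conj_class_eq:
  assumes a: "a \<in> carrier G" and b: "b \<in> conj_class G a"
  shows "conj_class G b = conj_class G a"
proof -
  obtain h where h: "h \<in> carrier G" and bh: "b = h \<otimes> a \<otimes> inv h"
    using b unfolding conj_class_def by auto
  have bc: "b \<in> carrier G" using h a bh by simp
  have ab: "a = inv h \<otimes> b \<otimes> inv (inv h)"
    unfolding bh using conj_conj[of "inv h" h a] h a by simp
  show ?thesis
  proof (intro equalityI subsetI)
    fix x assume "x \<in> conj_class G b"
    then obtain g where "g \<in> carrier G" "x = g \<otimes> b \<otimes> inv g"
      unfolding conj_class_def by auto
    then show "x \<in> conj_class G a"
      unfolding conj_class_def bh using conj_conj[of g h a] h a by auto
  next
    fix x assume "x \<in> conj_class G a"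
    then obtain g where g: "g \<in> carrier G" "x = g \<otimes> a \<otimes> inv g"
      unfolding conj_class_def by auto
    then have "x = (g \<otimes> inv h) \<otimes> b \<otimes> inv (g \<otimes> inv h)"
      using conj_conj[of g "inv h" b] h bc ab by simp
    then show "x \<in> conj_class G b"
      unfolding conj_class_def using g h by blast
  qed
qed

lemma Union_conj_classes:
  assumes "conj_invariant G X"
  shows "\<Union> (conj_class G ` X) = X"
proof
  show "\<Union> (conj_class G ` X) \<subseteq> X"
    using assms unfolding conj_invariant_def conj_class_def by auto
  show "X \<subseteq> \<Union> (conj_class G ` X)"
    using assms conj_class_refl unfolding conj_invariant_def by blast
qed

lemma eta_eq_card:
  assumes "F \<subseteq> conj_class G ` carrier G" and "\<Union> F = X"
  shows "eta G X = card F"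
proof -
  have "conj_class G ` X = F"
  proof (intro equalityI subsetI)
    fix C assume "C \<in> conj_class G ` X"
    then obtain x D where "C = conj_class G x" "x \<in> D" "D \<in> F"
      using assms(2) by auto
    moreover from this assms(1) obtain a where "a \<in> carrier G" "D = conj_class G a"
      by auto
    ultimately show "C \<in> F" using conj_class_eq by metis
  next
    fix C assume C: "C \<in> F"
    then obtain a where "a \<in> carrier G" "C = conj_class G a" using assms(1) by auto
    then show "C \<in> conj_class G ` X" using C conj_class_refl assms(2) by blast
  qed
  then show ?thesis by (simp add: eta_def)
qed

lemma conj_invariant_conj_class_mult:
  assumes a: "a \<in> carrier G" and b: "b \<in> carrier G"
  shows "conj_invariant G (conj_class G a <#> conj_class G b)"
proof -
  have sub: "conj_class G a <#> conj_class G b \<subseteq> carrier G"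
    using conj_class_subset[OF a] conj_class_subset[OF b] by (rule set_mult_closed)
  have "g \<otimes> (x \<otimes> y) \<otimes> inv g \<in> conj_class G a <#> conj_class G b"
    if g: "g \<in> carrier G" and x: "x \<in> conj_class G a" and y: "y \<in> conj_class G b" for g x y
  proof -
    have xc: "x \<in> carrier G" and yc: "y \<in> carrier G"
      using conj_class_subset a b x y by auto
    have "g \<otimes> x \<otimes> inv g \<in> conj_class G x" "g \<otimes> y \<otimes> inv g \<in> conj_class G y"
      using g unfolding conj_class_def by auto
    then have "g \<otimes> x \<otimes> inv g \<in> conj_class G a" "g \<otimes> y \<otimes> inv g \<in> conj_class G b"
      using conj_class_eq[OF a x] conj_class_eq[OF b y] by auto
    moreover have "g \<otimes> (x \<otimes> y) \<otimes> inv g = (g \<otimes> x \<otimes> inv g) \<otimes> (g \<otimes> y \<otimes> inv g)"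
    proof -
      have "inv g \<otimes> (g \<otimes> (y \<otimes> inv g)) = y \<otimes> inv g"
        using g yc by (metis inv_closed l_inv l_one m_assoc m_closed)
      then show ?thesis using g xc yc by (simp add: m_assoc)
    qed
    ultimately show ?thesis unfolding set_mult_def by blast
  qed
  then show ?thesis using sub unfolding conj_invariant_def set_mult_def by blast
qed

end

end

theory Submission
  imports Defs "HOL-Number_Theory.Cong" "HOL-Algebra.Weak_Morphisms" "HOL-Library.Nat_Bijection"
begin

text \<open>
  The idea is to find an abelian normal subgroup whose conjugacy classes in the whole group
  are the layers of the \<open>p\<close>-adic filtration, split by leading digit, and then an element \<open>a\<close>
  whose class is a coset of a step of that filtration.

  Let \<open>l = n + 1\<close> and \<open>R = \<int>/p\<^sup>l\<close>, and let the group \<open>U\<close> of residues congruent to \<open>1\<close> modulo \<open>p\<close>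
  act on \<open>R\<close> by multiplication.  A nonzero element of \<open>R\<close> is \<open>p\<^sup>i w\<close> with \<open>w\<close> prime to \<open>p\<close>,
  and its orbit consists of all \<open>p\<^sup>i w'\<close> with \<open>w'\<close> congruent to \<open>w\<close> modulo \<open>p\<close>.  So the nonzero
  orbits correspond to the pairs \<open>(i, u)\<close> of a valuation \<open>i < l\<close> and a leading digit \<open>0 < u < p\<close>
  (lemmas \<open>ex_leading_digit_orbit\<close> and \<open>leading_digit_orbit_unique\<close>).  The ideal \<open>pR\<close>, which
  excludes \<open>i = 0\<close>, is therefore the union of \<open>n (p - 1) + 1\<close> orbits.

  In the semidirect product of \<open>R\<close> by \<open>U\<close>, the group of maps \<open>x \<mapsto> h x + b\<close>, the normal subgroup of
  translations is \<open>R\<close>, and its conjugacy classes are the \<open>U\<close>-orbits.  For the homothety \<open>a\<close> with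
  factor \<open>1 + p\<close>, conjugating by translations changes the translation part by multiples of \<open>p\<close>,
  so the class of \<open>a\<close> is \<open>a\<close> times \<open>pR\<close>, of size \<open>p\<^sup>n\<close>.  The quotients of two of its
  elements are exactly the translations in \<open>pR\<close>, which gives
  \<open>\<eta>(Cl(a) Cl(a\<^sup>-\<^sup>1)) = n (p - 1) + 1\<close>.

  For \<open>Cl(a) \<noteq> Cl(a\<^sup>-\<^sup>1)\<close> it suffices that \<open>(1 + p)\<^sup>2 \<noteq> 1\<close> in \<open>U\<close>, because conjugation keeps the
  factor of a map.  This fails modulo \<open>p\<^sup>l\<close> for small \<open>n\<close>, for instance when \<open>p = 2\<close> and \<open>n \<le> 2\<close>.
  Therefore \<open>U\<close> is taken modulo a higher power \<open>p\<^sup>m\<close>, still acting on \<open>R\<close> through reduction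
  modulo \<open>p\<^sup>l\<close>; with \<open>m \<ge> 4\<close> one has \<open>1 < (1 + p)\<^sup>2 < p\<^sup>m\<close>, for \<open>p = 2\<close> as well.
\<close>

section \<open>Conjugacy classes and isomorphisms\<close>

text \<open>
  This form avoids inverses, whose explicit formula in the affine group is awkward.
\<close>

lemma (in group) mem_conj_class_iff:
  assumes "x \<in> carrier G" "y \<in> carrier G"
  shows "y \<in> conj_class G x \<longleftrightarrow> (\<exists>g\<in>carrier G. g \<otimes> x = y \<otimes> g)"
proof -
  have "y = g \<otimes> x \<otimes> inv g \<longleftrightarrow> g \<otimes> x = y \<otimes> g" if "g \<in> carrier G" for g
    using that assms inv_solve_right[of y "g \<otimes> x" g] by auto
  then show ?thesis unfolding conj_class_def by blast
qed

lemma (in group) conj_class_inv: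
  assumes "a \<in> carrier G"
  shows "conj_class G (inv a) = m_inv G ` conj_class G a"
proof -
  have "inv (g \<otimes> a \<otimes> inv g) = g \<otimes> inv a \<otimes> inv g" if "g \<in> carrier G" for g
    using that assms by (simp add: inv_mult_group m_assoc)
  then show ?thesis
    unfolding conj_class_def image_def by (auto; metis)
qed

lemma (in group_hom) conj_class_iso_image:
  assumes "h \<in> iso G H" "a \<in> carrier G"
  shows "conj_class H (h a) = h ` conj_class G a"
proof -
  have "h (g \<otimes> a \<otimes> inv g) = h g \<otimes>\<^bsub>H\<^esub> h a \<otimes>\<^bsub>H\<^esub> inv\<^bsub>H\<^esub> h g" if "g \<in> carrier G" for g
    using that assms by simp
  moreover have "carrier H = h ` carrier G"
    using assms(1) by (auto simp: iso_def bij_betw_def)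
  ultimately show ?thesis
    unfolding conj_class_def image_def by (auto; metis)
qed

lemma (in group_hom) eta_iso_image:
  assumes h: "h \<in> iso G H" and X: "X \<subseteq> carrier G"
  shows "eta H (h ` X) = eta G X"
proof -
  have "conj_class H ` h ` X = (`) h ` conj_class G ` X"
    unfolding image_image using X by (intro image_cong refl conj_class_iso_image[OF h]) blast
  moreover have "inj_on ((`) h) (conj_class G ` X)"
  proof (rule inj_on_subset[OF inj_on_image_Pow])
    show "inj_on h (carrier G)" using h by (auto simp: iso_def bij_betw_def)
    show "conj_class G ` X \<subseteq> Pow (carrier G)"
      using X G.conj_class_subset by blast
  qed
  ultimately show ?thesis
    by (simp add: eta_def card_image)
qed

text \<open>
  The group below is built on pairs of residues.  Transporting its structure along an
  injective encoding into the natural numbers keeps everything that the theorem speaks about.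
\<close>

lemma (in group) image_group_conj_class_invariants:
  assumes inj: "inj_on f (carrier G)" and a: "a \<in> carrier G"
  defines "H \<equiv> image_group f G"
  shows "group H" "f a \<in> carrier H" "card (carrier H) = card (carrier G)"
    "finite (carrier H) \<longleftrightarrow> finite (carrier G)"
    "card (conj_class H (f a)) = card (conj_class G a)"
    "conj_class H (f a) = conj_class H (inv\<^bsub>H\<^esub> f a) \<longleftrightarrow> conj_class G a = conj_class G (inv a)"
    "eta H (conj_class H (f a) <#>\<^bsub>H\<^esub> conj_class H (inv\<^bsub>H\<^esub> f a)) =
      eta G (conj_class G a <#> conj_class G (inv a))"
proof -
  show grp: "group H"
    unfolding H_def by (rule inj_imp_image_group_is_group[OF inj])
  have iso: "f \<in> iso G H"
    unfolding H_def by (rule inj_imp_image_group_iso[OF inj])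
  have sub: "conj_class G a \<subseteq> carrier G" "conj_class G (inv a) \<subseteq> carrier G"
    using conj_class_subset a by auto
  note mult_sub = set_mult_closed[OF sub]
  interpret group_hom G H f
    using grp iso by (simp add: group_hom_def group_hom_axioms_def iso_iff is_group)
  show "f a \<in> carrier H" using a by simp
  show "card (carrier H) = card (carrier G)" "finite (carrier H) \<longleftrightarrow> finite (carrier G)"
    using iso iso_same_card iso_finite is_isoI by metis+
  have cl: "conj_class H (f a) = f ` conj_class G a"
       "conj_class H (inv\<^bsub>H\<^esub> f a) = f ` conj_class G (inv a)"
    using conj_class_iso_image[OF iso] a hom_inv[OF a] by (auto simp flip: hom_inv)
  show "card (conj_class H (f a)) = card (conj_class G a)"
    unfolding cl using inj sub by (meson card_image inj_on_subset)
  show "conj_class H (f a) = conj_class H (inv\<^bsub>H\<^esub> f a) \<longleftrightarrow> conj_class G a = conj_class G (inv a)"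
    unfolding cl by (rule inj_on_image_eq_iff[OF inj sub])
  show "eta H (conj_class H (f a) <#>\<^bsub>H\<^esub> conj_class H (inv\<^bsub>H\<^esub> f a)) =
      eta G (conj_class G a <#> conj_class G (inv a))"
    unfolding cl
    using set_mult_hom[OF homh sub] eta_iso_image[OF iso mult_sub] by simp
qed

section \<open>Residues congruent to one modulo p\<close>

lemma ex_inverse_cong_one:
  fixes p m h :: nat
  assumes p: "prime p" and m: "0 < m" and h: "[h = 1] (mod p)"
  shows "\<exists>k<p ^ m. [k = 1] (mod p) \<and> [k * h = 1] (mod p ^ m)"
proof -
  have "coprime h p"
    using cong_imp_coprime[OF cong_sym[OF h]] by simp
  then have "coprime h (p ^ m)" by simp
  then obtain k where k: "[h * k = 1] (mod p ^ m)"
    using cong_solve_coprime_nat[of h "p ^ m"] by auto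
  have "p dvd p ^ m" using m by simp
  then have "[h * k = 1] (mod p)" using k cong_dvd_modulus_nat by blast
  moreover have "[h * k = k] (mod p)" using cong_scalar_right[OF h, of k] by simp
  ultimately have "[k = 1] (mod p)" by (metis cong_def)
  then have "[k mod p ^ m = 1] (mod p)"
    using \<open>p dvd p ^ m\<close> by (simp add: cong_def mod_mod_cancel)
  moreover have "[(k mod p ^ m) * h = k * h] (mod p ^ m)" by (intro cong_mult) auto
  then have "[(k mod p ^ m) * h = 1] (mod p ^ m)"
    using k by (metis cong_trans mult.commute)
  moreover have "k mod p ^ m < p ^ m" using p prime_gt_0_nat by simp
  ultimately show ?thesis by blast
qed

lemma card_less_cong_one:
  fixes p m :: nat
  assumes p: "1 < p"
  shows "card {h. h < p ^ Suc m \<and> [h = 1] (mod p)} = p ^ m"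
proof -
  have "{h. h < p ^ Suc m \<and> [h = 1] (mod p)} = (\<lambda>k. k * p + 1) ` {..<p ^ m}"
  proof (intro equalityI subsetI)
    fix h assume "h \<in> {h. h < p ^ Suc m \<and> [h = 1] (mod p)}"
    then have h: "h < p ^ Suc m" "h mod p = 1" using p by (auto simp: cong_def)
    then have "h = h div p * p + 1" by (metis div_mult_mod_eq)
    moreover have "h div p < p ^ m"
      using h(1) by (simp add: less_mult_imp_div_less mult.commute)
    ultimately show "h \<in> (\<lambda>k. k * p + 1) ` {..<p ^ m}" by blast
  next
    fix h assume "h \<in> (\<lambda>k. k * p + 1) ` {..<p ^ m}"
    then obtain k where k: "k < p ^ m" "h = k * p + 1" by blast
    have "(k + 1) * p \<le> p ^ m * p" using k(1) by (intro mult_right_mono) auto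
    then have "h < p ^ Suc m" using k p by (simp add: algebra_simps)
    moreover have "[h = 1] (mod p)" unfolding k(2) cong_def by (rule mod_mult_self3)
    ultimately show "h \<in> {h. h < p ^ Suc m \<and> [h = 1] (mod p)}" by blast
  qed
  moreover have "inj_on (\<lambda>k. k * p + 1) {..<p ^ m}" using p by (auto simp: inj_on_def)
  ultimately show ?thesis by (simp add: card_image)
qed

lemma card_less_dvd:
  fixes p l :: nat
  assumes p: "0 < p"
  shows "card {d. d < p ^ Suc l \<and> p dvd d} = p ^ l"
proof -
  have "{d. d < p ^ Suc l \<and> p dvd d} = (*) p ` {..<p ^ l}"
    using p by (auto elim!: dvdE)
  moreover have "inj_on ((*) p) {..<p ^ l}" using p by (auto simp: inj_on_def)
  ultimately show ?thesis by (simp add: card_image)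
qed

text \<open>
  Multiplication by residues congruent to \<open>1\<close> modulo \<open>p\<close> can reduce any \<open>w\<close> prime to \<open>p\<close> to
  its last digit \<open>u\<close>: the factor \<open>w / u\<close> is well defined modulo \<open>p\<^sup>l\<close> and congruent to \<open>1\<close>
  modulo \<open>p\<close>.  Applying this to the part of \<open>z\<close> prime to \<open>p\<close> makes every nonzero \<open>z\<close>
  equivalent to its lowest nonzero digit, kept in its place.
\<close>

lemma ex_leading_digit_orbit:
  fixes p l z :: nat
  assumes p: "prime p" and z: "0 < z" "z < p ^ l"
  obtains i u k where "i < l" "0 < u" "u < p" "[k = 1] (mod p)" "[k * (p ^ i * u) = z] (mod p ^ l)"
    "p dvd z \<longrightarrow> 0 < i"
proof -
  have "z \<noteq> 0" "\<not> is_unit p" using z p by auto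
  then obtain w where w: "z = p ^ multiplicity p z * w" "\<not> p dvd w"
    by (metis multiplicity_decompose')
  define i u where "i = multiplicity p z" and "u = w mod p"
  have p0: "0 < p" using p prime_gt_0_nat by blast
  have u: "0 < u" "u < p"
    using w(2) p0 by (auto simp: u_def mod_greater_zero_iff_not_dvd)
  have "p ^ i \<le> z" using w z by (metis dvd_imp_le dvd_triv_left i_def)
  then have "p ^ i < p ^ l" using z(2) by linarith
  then have il: "i < l" using p prime_gt_1_nat power_less_imp_less_exp by blast
  have "coprime u (p ^ l)"
    using u p by (metis coprime_commute coprime_power_right_iff nat_dvd_not_less prime_imp_coprime)
  then obtain v where v: "[u * v = 1] (mod p ^ l)"
    using cong_solve_coprime_nat[of u "p ^ l"] by auto
  have "[u * v * w = w] (mod p ^ l)"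
    using cong_scalar_right[OF v, of w] by simp
  then have kw: "[(v * w) * u = w] (mod p ^ l)" by (simp add: ac_simps)
  moreover have "p dvd p ^ l" using il by simp
  ultimately have "[(v * w) * u = w] (mod p)" using cong_dvd_modulus_nat by blast
  moreover have "[w = 1 * u] (mod p)" by (simp add: u_def)
  ultimately have "[(v * w) * u = 1 * u] (mod p)" by (rule cong_trans)
  moreover have "coprime u p"
    using u p by (metis coprime_commute nat_dvd_not_less prime_imp_coprime)
  ultimately have "[v * w = 1] (mod p)" by (simp only: cong_mult_rcancel_nat)
  moreover have "[(v * w) * (p ^ i * u) = z] (mod p ^ l)"
    using cong_scalar_left[OF kw, of "p ^ i"] w by (simp add: i_def ac_simps)
  moreover have "p dvd z \<longrightarrow> 0 < i"
    using w u by (metis i_def mult_1 neq0_conv power_0)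
  ultimately show ?thesis using il u that by blast
qed

text \<open>
  Modulo \<open>p\<^sup>i\<^sup>+\<^sup>1\<close>, where \<open>i\<close> is the smaller of the two valuations, the factor \<open>k\<close> becomes
  invisible and only the digit in place \<open>i\<close> remains.
\<close>

lemma leading_digit_orbit_unique:
  fixes p l k i j u v :: nat
  assumes k: "[k = 1] (mod p)" and i: "i < l" and ij: "i \<le> j" and u: "0 < u" "u < p" and v: "v < p"
    and eq: "[p ^ j * v = k * (p ^ i * u)] (mod p ^ l)"
  shows "i = j \<and> u = v"
proof -
  have "p ^ Suc i dvd p ^ l" using i by (intro le_imp_power_dvd) simp
  then have "[p ^ j * v = k * (p ^ i * u)] (mod p ^ Suc i)"
    using eq cong_dvd_modulus_nat by blast
  moreover have "[k * (p ^ i * u) = p ^ i * u] (mod p ^ Suc i)"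
    using cong_cmult_leftI[OF cong_scalar_right[OF k, of u], of "p ^ i"] by (simp add: ac_simps)
  ultimately have "[p ^ j * v = p ^ i * u] (mod p ^ Suc i)" by (rule cong_trans)
  moreover have "p ^ j * v = p ^ i * (p ^ (j - i) * v)"
    using ij by (simp flip: power_add mult.assoc)
  ultimately have "p ^ i * (p ^ (j - i) * v mod p) = p ^ i * (u mod p)"
    unfolding mult_mod_right by (simp only: cong_def power_Suc2)
  then have *: "p ^ (j - i) * v mod p = u" using u by simp
  show ?thesis
  proof (cases "i = j")
    case True then show ?thesis using * v by simp
  next
    case False
    then have "p dvd p ^ (j - i) * v" using ij by simp
    then show ?thesis using * u by simp
  qed
qed

section \<open>The affine group and its conjugacy classes\<close>

text \<open>
  The pair \<open>(h, b)\<close> stands for \<open>x \<mapsto> h x + b\<close> on the residues modulo \<open>p\<^sup>l\<close>.  The factor \<open>h\<close> is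
  remembered modulo \<open>p\<^sup>m\<close>, so for \<open>l < m\<close> different pairs may act in the same way.
\<close>

definition affine_group :: "nat \<Rightarrow> nat \<Rightarrow> nat \<Rightarrow> (nat \<times> nat) monoid" where
  "affine_group p m l =
    \<lparr>carrier = {h. h < p ^ m \<and> [h = 1] (mod p)} \<times> {..<p ^ l},
     mult = \<lambda>(h, b) (k, c). (h * k mod p ^ m, (b + h * c) mod p ^ l),
     one = (1, 0)\<rparr>"

locale affine =
  fixes p m l :: nat
  assumes prime_p: "prime p" and l_pos: "0 < l" and l_le_m: "l \<le> m"
begin

abbreviation A :: "(nat \<times> nat) monoid" where "A \<equiv> affine_group p m l"

lemma p_gt_1: "1 < p" using prime_p prime_gt_1_nat by blast

lemma p_pos [simp]: "0 < p" using p_gt_1 by simp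

lemma Suc_p_less_square: "1 + p < p ^ 2"
proof -
  have "2 * p \<le> p * p" using p_gt_1 by (intro mult_right_mono) auto
  then show ?thesis unfolding power2_eq_square using p_gt_1 by linarith
qed

lemma dvd_powers: "p dvd p ^ l" "p dvd p ^ m" "p ^ l dvd p ^ m"
  using l_pos l_le_m by (auto simp: le_imp_power_dvd)

lemma powers_gt_1: "1 < p ^ l" "1 < p ^ m"
  using one_less_power[OF p_gt_1] l_pos l_le_m by auto

lemma carrier_affine [simp]:
  "(h, b) \<in> carrier A \<longleftrightarrow> h < p ^ m \<and> [h = 1] (mod p) \<and> b < p ^ l"
  by (auto simp: affine_group_def)

lemma mult_affine [simp]:
  "(h, b) \<otimes>\<^bsub>A\<^esub> (k, c) = (h * k mod p ^ m, (b + h * c) mod p ^ l)"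
  by (simp add: affine_group_def)

lemma one_affine [simp]: "\<one>\<^bsub>A\<^esub> = (1, 0)"
  by (simp add: affine_group_def)

lemma mod_m_mod_l: "[x mod p ^ m = x] (mod p ^ l)"
  using dvd_powers by (simp add: cong_def mod_mod_cancel)

lemma mod_m_mod_p: "[x mod p ^ m = y] (mod p) \<longleftrightarrow> [x = y] (mod p)"
  using dvd_powers by (simp add: cong_def mod_mod_cancel)

lemma ex_inverse:
  assumes "[h = 1] (mod p)"
  obtains k where "k < p ^ m" "[k = 1] (mod p)" "[k * h = 1] (mod p ^ m)"
  using ex_inverse_cong_one[OF prime_p _ assms, of m] l_pos l_le_m by auto

lemma group_affine: "group A"
proof (rule groupI)
  show "\<one>\<^bsub>A\<^esub> \<in> carrier A" using powers_gt_1 by simp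
next
  fix x y assume xy: "x \<in> carrier A" "y \<in> carrier A"
  obtain h b k c where "x = (h, b)" "y = (k, c)" by fastforce
  with xy show "x \<otimes>\<^bsub>A\<^esub> y \<in> carrier A"
    using powers_gt_1 cong_mult[of h 1 p k 1] by (auto simp: mod_m_mod_p)
next
  fix x y z assume xyz: "x \<in> carrier A" "y \<in> carrier A" "z \<in> carrier A"
  obtain h b k c r d where e: "x = (h, b)" "y = (k, c)" "z = (r, d)" by (metis surj_pair)
  have "[(b + h * c) mod p ^ l + (h * k mod p ^ m) * d = (b + h * c) + h * k * d] (mod p ^ l)"
    by (intro cong_add cong_mult mod_m_mod_l cong_refl) simp
  also have "(b + h * c) + h * k * d = b + h * (c + k * d)"
    by (simp add: algebra_simps)
  also have "[b + h * (c + k * d) = b + h * ((c + k * d) mod p ^ l)] (mod p ^ l)"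
    by (intro cong_add cong_mult) auto
  finally show "x \<otimes>\<^bsub>A\<^esub> y \<otimes>\<^bsub>A\<^esub> z = x \<otimes>\<^bsub>A\<^esub> (y \<otimes>\<^bsub>A\<^esub> z)"
    unfolding e by (simp add: cong_def mod_simps mult.assoc)
next
  fix x assume "x \<in> carrier A"
  then show "\<one>\<^bsub>A\<^esub> \<otimes>\<^bsub>A\<^esub> x = x" by (cases x) auto
next
  fix x assume x: "x \<in> carrier A"
  obtain h b where e: "x = (h, b)" by fastforce
  obtain k where k: "k < p ^ m" "[k = 1] (mod p)" "[k * h = 1] (mod p ^ m)"
    using ex_inverse x e by auto
  have kb: "k * (p ^ l - b) + k * b = k * p ^ l"
    using x e by (simp flip: distrib_left)
  show "\<exists>y\<in>carrier A. y \<otimes>\<^bsub>A\<^esub> x = \<one>\<^bsub>A\<^esub>"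
  proof
    \<comment> \<open>The translation part is \<open>- k b\<close>, written without subtracting below zero.\<close>
    show "(k, k * (p ^ l - b) mod p ^ l) \<in> carrier A" using k powers_gt_1 by simp
    show "(k, k * (p ^ l - b) mod p ^ l) \<otimes>\<^bsub>A\<^esub> x = \<one>\<^bsub>A\<^esub>"
      using k p_gt_1 l_pos l_le_m kb unfolding e by (simp add: cong_def mod_simps)
  qed
qed

sublocale group A by (rule group_affine)

lemma finite_p_group_affine: "finite_p_group p A"
proof -
  have "card (carrier A) = p ^ (m - 1) * p ^ l"
    using card_less_cong_one[OF p_gt_1, of "m - 1"] l_pos l_le_m
    by (simp add: affine_group_def card_cartesian_product)
  moreover have "finite (carrier A)" by (simp add: affine_group_def)
  ultimately show ?thesis
    using group_affine unfolding finite_p_group_def by (metis power_add)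
qed

text \<open>
  The factors commute, so conjugation changes only the translation part.  The congruence
  compares the translation parts of \<open>(k, c) (h, b)\<close> and \<open>(h, d) (k, c)\<close>.
\<close>

lemma conj_class_affine:
  assumes hb: "(h, b) \<in> carrier A"
  shows "conj_class A (h, b) =
    {h} \<times> {d. d < p ^ l \<and> (\<exists>k c. [k = 1] (mod p) \<and> [d + h * c = c + k * b] (mod p ^ l))}"
    (is "_ = {h} \<times> ?D")
proof (intro equalityI subsetI)
  fix x assume x: "x \<in> conj_class A (h, b)"
  obtain h' d where e: "x = (h', d)" by fastforce
  have xc: "(h', d) \<in> carrier A" using x hb conj_class_subset e by blast
  obtain k c where kc: "(k, c) \<in> carrier A" "(k, c) \<otimes>\<^bsub>A\<^esub> (h, b) = (h', d) \<otimes>\<^bsub>A\<^esub> (k, c)"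
    using x mem_conj_class_iff[OF hb xc] e by auto
  then have "[h * k = h' * k] (mod p ^ m)" by (simp add: cong_def mult.commute)
  moreover have "coprime k p"
    using kc(1) cong_imp_coprime[OF cong_sym, of k 1 p] by simp
  then have "coprime k (p ^ m)" by simp
  ultimately have "h' = h"
    using hb xc by (metis carrier_affine cong_less_modulus_unique_nat cong_mult_rcancel_nat)
  moreover have "[d + h * c = c + k * b] (mod p ^ l)"
    using kc \<open>h' = h\<close> by (simp add: cong_def)
  ultimately show "x \<in> {h} \<times> ?D" using e xc kc by auto
next
  fix x assume "x \<in> {h} \<times> ?D"
  then obtain d k c where e: "x = (h, d)" "d < p ^ l" "[k = 1] (mod p)"
    "[d + h * c = c + k * b] (mod p ^ l)" by auto
  let ?g = "(k mod p ^ m, c mod p ^ l)"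
  have g: "?g \<in> carrier A" using e powers_gt_1 by (simp add: mod_m_mod_p)
  have xc: "x \<in> carrier A" using e hb by simp
  have "[c mod p ^ l + (k mod p ^ m) * b = c + k * b] (mod p ^ l)"
    by (intro cong_add cong_mult mod_m_mod_l cong_refl) simp
  also have "[c + k * b = d + h * c] (mod p ^ l)" using e by (simp add: cong_sym)
  also have "[d + h * c = d + h * (c mod p ^ l)] (mod p ^ l)"
    by (intro cong_add cong_mult) auto
  finally have "?g \<otimes>\<^bsub>A\<^esub> (h, b) = x \<otimes>\<^bsub>A\<^esub> ?g"
    unfolding e by (simp add: cong_def mod_simps mult.commute)
  then show "x \<in> conj_class A (h, b)"
    using mem_conj_class_iff[OF hb xc] g by blast
qed

lemma conj_class_homothety:
  assumes "1 < m"
  shows "(1 + p, 0) \<in> carrier A"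
    and "conj_class A (1 + p, 0) = {1 + p} \<times> {d. d < p ^ l \<and> p dvd d}"
proof -
  have "1 + p < p ^ 2" by (rule Suc_p_less_square)
  also have "\<dots> \<le> p ^ m" using p_gt_1 assms by (intro power_increasing) auto
  finally have "1 + p < p ^ m" .
  moreover have "[1 + p = 1] (mod p)"
    by (simp only: cong_add_lcancel_0_nat cong_0_iff dvd_refl)
  ultimately show a: "(1 + p, 0) \<in> carrier A" by simp
  have "(\<exists>k c. [k = 1] (mod p) \<and> [d + (1 + p) * c = c + k * 0] (mod p ^ l)) \<longleftrightarrow> p dvd d"
    (is "?L \<longleftrightarrow> ?R") if "d < p ^ l" for d
  proof
    assume ?L
    then obtain c where "[c + (d + p * c) = c + 0] (mod p ^ l)" by (auto simp: algebra_simps)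
    then have "[d + p * c = 0] (mod p ^ l)" by (simp only: cong_add_lcancel_nat)
    then have "p dvd d + p * c" using dvd_powers by (metis cong_0_iff dvd_trans)
    then show ?R by (simp add: dvd_add_left_iff)
  next
    assume ?R
    then obtain e where e: "d = p * e" by blast
    have "e \<le> p ^ l"
      using that e p_gt_1 by (metis le_trans less_imp_le_nat mult_le_mono1 mult_1)
    then obtain t where t: "p ^ l = e + t" using le_Suc_ex by blast
    \<comment> \<open>Conjugating by the translation by \<open>t\<close>, which represents \<open>- d / p\<close>, gives \<open>d\<close>.\<close>
    have "d + (1 + p) * t = t + p * p ^ l"
      unfolding e t by (simp add: algebra_simps)
    then have "[d + (1 + p) * t = t + 1 * 0] (mod p ^ l)"
      by (simp only: cong_def mod_mult_self1 mult_0_right add_0_right)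
    moreover have "[1 = 1] (mod p)" by simp
    ultimately show ?L by blast
  qed
  then show "conj_class A (1 + p, 0) = {1 + p} \<times> {d. d < p ^ l \<and> p dvd d}"
    unfolding conj_class_affine[OF a] by auto
qed

lemma conj_class_translation:
  assumes "b < p ^ l"
  shows "conj_class A (1, b) = {1} \<times> {d. d < p ^ l \<and> (\<exists>k. [k = 1] (mod p) \<and> [d = k * b] (mod p ^ l))}"
proof -
  have "[d + 1 * c = c + k * b] (mod p ^ l) \<longleftrightarrow> [d = k * b] (mod p ^ l)" for d c k
    using cong_add_lcancel_nat[of c d "k * b"] by (simp add: add.commute)
  moreover have "(1, b) \<in> carrier A" using assms powers_gt_1 by simp
  ultimately show ?thesis by (simp only: conj_class_affine) auto
qed

text \<open>
  Elements of the class of the homothety \<open>a\<close> all have the factor \<open>1 + p\<close>, so the quotient of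
  two of them is the translation by the difference of their translation parts.
\<close>

lemma conj_class_homothety_mult_inv:
  assumes "1 < m"
  defines "a \<equiv> (1 + p, 0)"
  shows "conj_class A a <#>\<^bsub>A\<^esub> conj_class A (inv\<^bsub>A\<^esub> a) = {1} \<times> {z. z < p ^ l \<and> p dvd z}"
proof -
  have a: "a \<in> carrier A" and cl: "conj_class A a = {1 + p} \<times> {d. d < p ^ l \<and> p dvd d}"
    unfolding a_def using conj_class_homothety[OF assms(1)] by auto
  let ?z = "\<lambda>d e. (d + (p ^ l - e)) mod p ^ l"
  have quot: "(1 + p, d) \<otimes>\<^bsub>A\<^esub> inv\<^bsub>A\<^esub> (1 + p, e) = (1, ?z d e)"
    if "d < p ^ l" "e < p ^ l" for d e
  proof (rule sym, subst inv_solve_right)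
    show "(1, ?z d e) \<in> carrier A" using powers_gt_1 by simp
    show "(1 + p, d) \<in> carrier A" "(1 + p, e) \<in> carrier A"
      using a that by (auto simp: a_def)
    have "1 + p < p ^ m" using a by (simp add: a_def)
    then show "(1 + p, d) = (1, ?z d e) \<otimes>\<^bsub>A\<^esub> (1 + p, e)"
      using that by (simp add: mod_simps)
  qed
  have "conj_class A a <#>\<^bsub>A\<^esub> conj_class A (inv\<^bsub>A\<^esub> a) =
    (\<lambda>(d, e). (1 + p, d) \<otimes>\<^bsub>A\<^esub> inv\<^bsub>A\<^esub> (1 + p, e)) `
      ({d. d < p ^ l \<and> p dvd d} \<times> {e. e < p ^ l \<and> p dvd e})"
    unfolding conj_class_inv[OF a] cl set_mult_def by force
  also have "\<dots> = (\<lambda>(d, e). (1, ?z d e)) `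
      ({d. d < p ^ l \<and> p dvd d} \<times> {e. e < p ^ l \<and> p dvd e})"
    using quot by (intro image_cong) auto
  also have "\<dots> = {1} \<times> {z. z < p ^ l \<and> p dvd z}"
  proof (intro equalityI subsetI)
    fix x assume "x \<in> (\<lambda>(d, e). (1::nat, ?z d e)) `
      ({d. d < p ^ l \<and> p dvd d} \<times> {e. e < p ^ l \<and> p dvd e})"
    then show "x \<in> {1} \<times> {z. z < p ^ l \<and> p dvd z}"
      using dvd_powers powers_gt_1 by (auto simp: dvd_mod_iff dvd_diff_nat)
  next
    fix x :: "nat \<times> nat" assume "x \<in> {1} \<times> {z. z < p ^ l \<and> p dvd z}"
    then obtain z where "x = (1, ?z z 0)" "z < p ^ l" "p dvd z" by auto
    moreover have "0 < p ^ l" "p dvd 0" using powers_gt_1 by auto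
    ultimately show "x \<in> (\<lambda>(d, e). (1::nat, ?z d e)) `
      ({d. d < p ^ l \<and> p dvd d} \<times> {e. e < p ^ l \<and> p dvd e})"
      by (intro image_eqI[of _ _ "(z, 0)"]) auto
  qed
  finally show ?thesis .
qed

text \<open>
  Here the classes are orbits of multiplication by residues congruent to \<open>1\<close> modulo \<open>p\<close>, and
  a system of representatives is \<open>0\<close> together with the \<open>p\<^sup>i u\<close>, for \<open>0 < i < l\<close> and
  \<open>0 < u < p\<close>.
\<close>

lemma eta_translations: "eta A ({1} \<times> {z. z < p ^ l \<and> p dvd z}) = (l - 1) * (p - 1) + 1"
proof -
  define f :: "nat \<times> nat \<Rightarrow> nat \<times> nat" where "f = (\<lambda>(i, u). (1, p ^ i * u))"
  define I where "I = {1..<l} \<times> {1..<p}"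
  let ?X = "{1::nat} \<times> {z. z < p ^ l \<and> p dvd z}"
  have bound: "p ^ i * u < p ^ l" if "i < l" "u < p" for i u
  proof -
    have "p ^ i * u < p ^ Suc i" using that by (simp add: p_gt_1)
    also have "\<dots> \<le> p ^ l" using that p_gt_1 by (intro power_increasing) auto
    finally show ?thesis .
  qed
  have sub: "insert (1, 0) (f ` I) \<subseteq> ?X"
    using bound powers_gt_1 by (auto simp: f_def I_def intro: dvd_mult2)
  have "conj_class A ` ?X = conj_class A ` insert (1, 0) (f ` I)"
  proof (intro equalityI subsetI)
    fix C assume "C \<in> conj_class A ` ?X"
    then obtain z where C: "C = conj_class A (1, z)" and z: "z < p ^ l" "p dvd z" by auto
    show "C \<in> conj_class A ` insert (1, 0) (f ` I)"
    proof (cases "z = 0")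
      case False
      then have "0 < z" by simp
      from ex_leading_digit_orbit[OF prime_p this z(1)] obtain i u k
        where iuk: "i < l" "0 < u" "u < p" "[k = 1] (mod p)" "[k * (p ^ i * u) = z] (mod p ^ l)" "0 < i"
        using z(2) by metis
      have "(1, z) \<in> conj_class A (1, p ^ i * u)"
        unfolding conj_class_translation[OF bound[OF iuk(1,3)]] using iuk z cong_sym by blast
      moreover have "(1, p ^ i * u) \<in> carrier A" using bound iuk powers_gt_1 by simp
      ultimately have "C = conj_class A (f (i, u))"
        unfolding C f_def using conj_class_eq by simp
      then show ?thesis using iuk by (auto simp: I_def)
    qed (use C in auto)
  qed (use sub in blast)
  moreover have inj: "inj_on (conj_class A \<circ> f) I"
  proof -
    have *: "(i, u) = (j, v)"
      if "(i, u) \<in> I" "(j, v) \<in> I" "conj_class A (f (i, u)) = conj_class A (f (j, v))" "i \<le> j" for i u j v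
    proof -
      have "f (j, v) \<in> carrier A"
        using that bound powers_gt_1 by (auto simp: f_def I_def)
      then have "f (j, v) \<in> conj_class A (f (i, u))" using that conj_class_refl by simp
      moreover have "p ^ i * u < p ^ l" using that bound by (auto simp: I_def)
      ultimately obtain k where "[k = 1] (mod p)" "[p ^ j * v = k * (p ^ i * u)] (mod p ^ l)"
        using conj_class_translation[of "p ^ i * u"] by (auto simp: f_def)
      then show ?thesis
        using leading_digit_orbit_unique[of k p i l j u v] that by (auto simp: I_def)
    qed
    show ?thesis
    proof (rule inj_onI)
      fix x y assume "x \<in> I" "y \<in> I" "(conj_class A \<circ> f) x = (conj_class A \<circ> f) y"
      then show "x = y"
        using *[of "fst x" "snd x" "fst y" "snd y"] *[of "fst y" "snd y" "fst x" "snd x"]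
        by (cases "fst x \<le> fst y") auto
    qed
  qed
  moreover have "conj_class A (1, 0) \<notin> conj_class A ` f ` I"
  proof
    assume "conj_class A (1, 0) \<in> conj_class A ` f ` I"
    then obtain i u where iu: "(i, u) \<in> I" "conj_class A (1, 0) = conj_class A (f (i, u))" by auto
    have "f (i, u) \<in> carrier A"
      using iu bound powers_gt_1 by (auto simp: f_def I_def)
    then have "f (i, u) \<in> conj_class A (1, 0)" using iu conj_class_refl by simp
    then have "p ^ i * u = 0"
      using iu bound powers_gt_1 conj_class_translation[of 0]
      by (auto simp: f_def I_def cong_def)
    then show False using iu p_gt_1 by (auto simp: I_def)
  qed
  moreover have "finite I" "card I = (l - 1) * (p - 1)" by (auto simp: I_def)
  ultimately show ?thesis
    using card_image[OF inj] by (simp add: eta_def image_comp)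
qed

text \<open>
  If the classes agreed, the inverse of \<open>a\<close> would have the factor \<open>1 + p\<close> too, and
  \<open>(1 + p)\<^sup>2\<close> would be \<open>1\<close> modulo \<open>p\<^sup>m\<close>.  But \<open>(1 + p)\<^sup>2 < p\<^sup>4\<close>.
\<close>

lemma conj_class_homothety_neq_inv:
  assumes "3 < m"
  shows "conj_class A (1 + p, 0) \<noteq> conj_class A (inv\<^bsub>A\<^esub> (1 + p, 0))"
proof
  let ?a = "(1 + p, 0)"
  have a: "?a \<in> carrier A" and cl: "conj_class A ?a = {1 + p} \<times> {d. d < p ^ l \<and> p dvd d}"
    using conj_class_homothety assms by auto
  assume "conj_class A ?a = conj_class A (inv\<^bsub>A\<^esub> ?a)"
  then have "inv\<^bsub>A\<^esub> ?a \<in> conj_class A ?a" using conj_class_refl a by simp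
  then obtain d where "inv\<^bsub>A\<^esub> ?a = (1 + p, d)" unfolding cl by auto
  then have "(1 + p, d) \<otimes>\<^bsub>A\<^esub> ?a = \<one>\<^bsub>A\<^esub>" using l_inv[OF a] by simp
  then have *: "(1 + p) * (1 + p) mod p ^ m = 1" by simp
  have "(1 + p) * (1 + p) < p ^ 2 * p ^ 2"
    using Suc_p_less_square by (intro mult_strict_mono) auto
  also have "\<dots> = p ^ 4" by (simp flip: power_add)
  also have "\<dots> \<le> p ^ m" using p_gt_1 assms by (intro power_increasing) auto
  finally show False using * p_gt_1 by simp
qed

end

section \<open>The construction\<close>

theorem proposition5p3:
  fixes p n :: nat
  assumes "Factorial_Ring.prime p"
  shows "\<exists>(G :: nat monoid) a.
    finite_p_group p G \<and> a \<in> carrier G \<and>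
    card (conj_class G a) = p ^ n \<and>
    conj_class G a \<noteq> conj_class G (inv\<^bsub>G\<^esub> a) \<and>
    eta G (conj_class G a <#>\<^bsub>G\<^esub> conj_class G (inv\<^bsub>G\<^esub> a)) = n * (p - 1) + 1"
proof -
  \<comment> \<open>The translations need \<open>p\<^sup>n\<close> multiples of \<open>p\<close>; the factors need a modulus of at least \<open>p\<^sup>4\<close>,
    and one divisible by \<open>p\<^sup>n\<^sup>+\<^sup>1\<close>.\<close>
  interpret affine p "n + 4" "n + 1" using assms by unfold_locales auto
  let ?a = "(1 + p, 0)" and ?H = "image_group prod_encode A"
  have m: "1 < n + 4" "3 < n + 4" by auto
  note a = conj_class_homothety(1)[OF m(1)]
  have "inj_on prod_encode (carrier A)" by (rule inj_prod_encode)
  note copy = image_group_conj_class_invariants[OF this a]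
  have "finite_p_group p ?H"
    using copy(1,3,4) finite_p_group_affine by (simp add: finite_p_group_def)
  moreover have "card (conj_class A ?a) = p ^ n"
    using conj_class_homothety(2)[OF m(1)] card_less_dvd[of p n] p_gt_1
    by (simp add: card_cartesian_product)
  moreover have "eta A (conj_class A ?a <#>\<^bsub>A\<^esub> conj_class A (inv\<^bsub>A\<^esub> ?a)) = n * (p - 1) + 1"
    using conj_class_homothety_mult_inv[OF m(1)] eta_translations by simp
  ultimately show ?thesis
    using copy conj_class_homothety_neq_inv[OF m(2)] by metis
qed

end
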